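(* Let $\Phi(a,b)$ be the $6\times 6$ array of vectors in $\mathbb{C}^6$, depending on real $a,b>0$ with $a^2+b^2=1$, defined in the context. Then the array $\Phi_{23}=\Phi\left(\frac{1}{\sqrt2},\frac{1}{\sqrt2}\right)$ is a quantum Latin square of order $6$ and its cardinality is $23$.
   Context: A quantum Latin square of order $n$, denoted $\mathrm{QLS}(n)$, is an $n\times n$ array of unit vectors in $\mathbb{C}^n$ such that every row and every column forms an orthonormal basis of $\mathbb{C}^n$. Two unit vectors $u,v$ are phase equivalent if $u=e^{i\alpha}v$ for some $\alpha\in\mathbb{R}$. The cardinality of a quantum Latin square is the number of distinct phase-equivalence classes among its $n^2$ entries. Let $e_0,\dots,e_5$ be the standard basis of $\mathbb{C}^6=\mathcal U\oplus\mathcal V$, where $\mathcal U=\operatorname{span}\{e_0,e_1,e_2,e_3\}$ and $\mathcal V=\operatorname{span}\{e_4,e_5\}$. Let $\rho=1/\sqrt2$, and let $a,b>0$ be real with $a^2+b^2=1$. A $4$-tuple $(t_0,t_1,t_2,t_3)$ denotes the vector $t_0e_0+t_1e_1+t_2e_2+t_3e_3\in\mathcal U$. Define the following vectors of $\mathcal U$: $A=(1,0,0,0)$, $B=(0,1,0,0)$, $C=(0,0,1,0)$, $D=(0,0,0,1)$, $E=(0,a,b\rho,b\rho)$, $F=(a,0,b\rho,-b\rho)$, $G=(b\rho,-b\rho,0,a)$, $H=(-b\rho,-b\rho,a,0)$, $I=(0,-b,a\rho,a\rho)$, $J=(-b,0,a\rho,-a\rho)$, $K=(-a\rho,a\rho,0,b)$,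 $L=(a\rho,a\rho,b,0)$, $M=(-a\rho,a\rho,b,0)$, $N=(b\rho,-b\rho,a,0)$, $O=(\rho,\rho,0,0)$, $P=(a\rho,a\rho,0,b)$, $Q=(-b\rho,-b\rho,0,a)$, $R=(-\rho,\rho,0,0)$, $S=(0,0,\rho,\rho)$, $T=(b,0,a\rho,-a\rho)$, $U=(-a,0,b\rho,-b\rho)$. Define in $\mathcal V$: $x=e_4$, $y=e_5$, $z=\rho(e_4+e_5)$, $w=\rho(e_4-e_5)$. Set $$\Phi(a,b)=\begin{pmatrix} x & A & y & B & C & D \\ y & x & E & F & G & H \\ I & y & x & J & K & L \\ M & D & N & z & O & w \\ P & C & Q & w & z & R \\ T & B & U & S & w & z \end{pmatrix}.$$ *)

theory Defs
  imports "HOL-Analysis.Analysis"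
begin

definition cinner :: "complex ^ 'n \<Rightarrow> complex ^ 'n \<Rightarrow> complex" where
  "cinner u v = (\<Sum>i\<in>UNIV. cnj (u $ i) * v $ i)"

text \<open>The inner product that the library puts on \<^typ>\<open>complex ^ 'n\<close> is the real part of
  \<^const>\<open>cinner\<close>, so it cannot express complex orthogonality; the library norm on this type is
  the Hermitian one. The span below is over the complex numbers.\<close>

definition orthonormal_basis :: "('i \<Rightarrow> complex ^ 'n) \<Rightarrow> bool" where
  "orthonormal_basis f \<longleftrightarrow>
     (\<forall>i. norm (f i) = 1) \<and>
     (\<forall>i j. i \<noteq> j \<longrightarrow> cinner (f i) (f j) = 0) \<and>
     vec.span (range f) = UNIV"

text \<open>An array is a matrix of vectors, with \<open>X $ i $ j\<close> the entry in row \<open>i\<close> and column \<open>j\<close>;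
  the order of the square is \<open>CARD('n)\<close>.\<close>

definition quantum_latin_square :: "(complex ^ 'n) ^ 'n ^ 'n \<Rightarrow> bool" where
  "quantum_latin_square X \<longleftrightarrow>
     (\<forall>i j. norm (X $ i $ j) = 1) \<and>
     (\<forall>i. orthonormal_basis (\<lambda>j. X $ i $ j)) \<and>
     (\<forall>j. orthonormal_basis (\<lambda>i. X $ i $ j))"

definition phase_equiv :: "((complex ^ 'n) \<times> (complex ^ 'n)) set" where
  "phase_equiv = {(u, v). norm u = 1 \<and> norm v = 1 \<and>
     (\<exists>\<alpha>::real. u = exp (\<i> * complex_of_real \<alpha>) *s v)}"

definition qls_cardinality :: "(complex ^ 'n) ^ 'n ^ 'n \<Rightarrow> nat" where
  "qls_cardinality X = card ({X $ i $ j | i j. True} // phase_equiv)"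

definition e :: "6 \<Rightarrow> complex ^ 6" where
  "e k = axis k 1"

definition tuple4 :: "real \<Rightarrow> real \<Rightarrow> real \<Rightarrow> real \<Rightarrow> complex ^ 6" where
  "tuple4 t0 t1 t2 t3 =
     complex_of_real t0 *s e 0 + complex_of_real t1 *s e 1 +
     complex_of_real t2 *s e 2 + complex_of_real t3 *s e 3"

text \<open>The library function \<^const>\<open>vector\<close> puts the entries of a list at the indices
  \<open>1, 2, \<dots>, 6\<close>, where \<open>6 = 0\<close> in the index type \<^typ>\<open>6\<close>; so rows and columns of the array are
  numbered from 1, while the basis vectors \<^const>\<open>e\<close> are numbered from 0.\<close>

definition Phi :: "real \<Rightarrow> real \<Rightarrow> (complex ^ 6) ^ 6 ^ 6" where
  "Phi a b = (let
     \<rho> = 1 / sqrt 2;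
     vA = tuple4 1 0 0 0;
     vB = tuple4 0 1 0 0;
     vC = tuple4 0 0 1 0;
     vD = tuple4 0 0 0 1;
     vE = tuple4 0 a (b*\<rho>) (b*\<rho>);
     vF = tuple4 a 0 (b*\<rho>) (-b*\<rho>);
     vG = tuple4 (b*\<rho>) (-b*\<rho>) 0 a;
     vH = tuple4 (-b*\<rho>) (-b*\<rho>) a 0;
     vI = tuple4 0 (-b) (a*\<rho>) (a*\<rho>);
     vJ = tuple4 (-b) 0 (a*\<rho>) (-a*\<rho>);
     vK = tuple4 (-a*\<rho>) (a*\<rho>) 0 b;
     vL = tuple4 (a*\<rho>) (a*\<rho>) b 0;
     vM = tuple4 (-a*\<rho>) (a*\<rho>) b 0;
     vN = tuple4 (b*\<rho>) (-b*\<rho>) a 0;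
     vO = tuple4 \<rho> \<rho> 0 0;
     vP = tuple4 (a*\<rho>) (a*\<rho>) 0 b;
     vQ = tuple4 (-b*\<rho>) (-b*\<rho>) 0 a;
     vR = tuple4 (-\<rho>) \<rho> 0 0;
     vS = tuple4 0 0 \<rho> \<rho>;
     vT = tuple4 b 0 (a*\<rho>) (-a*\<rho>);
     vU = tuple4 (-a) 0 (b*\<rho>) (-b*\<rho>);
     x = e 4;
     y = e 5;
     z = complex_of_real \<rho> *s (e 4 + e 5);
     w = complex_of_real \<rho> *s (e 4 - e 5)
   in vector [
     vector [x,  vA, y,  vB, vC, vD],
     vector [y,  x,  vE, vF, vG, vH],
     vector [vI, y,  x,  vJ, vK, vL],
     vector [vM, vD, vN, z,  vO, w ],
     vector [vP, vC, vQ, w,  z,  vR],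
     vector [vT, vB, vU, vS, w,  z ]])"

definition Phi23 :: "(complex ^ 6) ^ 6 ^ 6" where
  "Phi23 = Phi (1 / sqrt 2) (1 / sqrt 2)"

end

theory Submission
  imports Defs
begin

text \<open>At a = b = 1/sqrt 2 every coordinate of every entry is sqrt k / 2 for an integer k in
  {0, 1, -1, 2, -2, 4, -4}, where sqrt is extended to the negative reals as an odd function. An
  entry is thus coded by six integers, and norms, inner products, equality and negation can all be
  read off the codes (\<open>norm_sqrt_vec\<close>, \<open>cinner_sqrt_vec\<close>,
  \<open>sqrt_vec_eq_iff\<close>, \<open>sqrt_vec_uminus\<close>).

  The Latin square property becomes a finite check on the table \<open>codes\<close> and its
  transpose, because six orthonormal vectors in dimension 6 already span
  (\<open>orthonormal_basisI\<close>).

  For the cardinality, all entries are real, so two phase equivalent ones agree up to sign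
  (\<open>phase_equiv_real\<close>). No entry is the negative of an entry, so the classes correspond
  to the distinct codes. The array has 25 named vectors; at a = b exactly F = T and J = U coincide,
  which leaves 23.\<close>

lemma UNIV_6: "(UNIV :: 6 set) = {0, 1, 2, 3, 4, 5}"
proof -
  have "card {0, 1, 2, 3, 4, 5 :: 6} = card (UNIV :: 6 set)"
    by simp
  then show ?thesis
    by (metis card_subset_eq finite subset_UNIV)
qed

lemma forall_6: "(\<forall>i::6. P i) \<longleftrightarrow> P 0 \<and> P 1 \<and> P 2 \<and> P 3 \<and> P 4 \<and> P 5"
  using UNIV_6 by (metis (full_types) UNIV_I insertE singletonD)

lemma sum_6: "sum f (UNIV :: 6 set) = f 0 + f 1 + f 2 + f 3 + f 4 + f 5"
  unfolding UNIV_6 by (simp add: algebra_simps)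

section \<open>Arrays of order 6 given by lists\<close>

lemma vector_6:
  "(vector [u1, u2, u3, u4, u5, u6] :: 'a::zero ^ 6) $ 1 = u1"
  "(vector [u1, u2, u3, u4, u5, u6] :: 'a::zero ^ 6) $ 2 = u2"
  "(vector [u1, u2, u3, u4, u5, u6] :: 'a::zero ^ 6) $ 3 = u3"
  "(vector [u1, u2, u3, u4, u5, u6] :: 'a::zero ^ 6) $ 4 = u4"
  "(vector [u1, u2, u3, u4, u5, u6] :: 'a::zero ^ 6) $ 5 = u5"
  "(vector [u1, u2, u3, u4, u5, u6] :: 'a::zero ^ 6) $ 0 = u6"
  unfolding vector_def by simp_all

text \<open>As \<open>6 = 0\<close> in the index type, \<^const>\<open>vector\<close> puts the last entry of a list of length 6 at index \<open>0\<close>.\<close>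

definition list_pos :: "6 \<Rightarrow> nat" where
  "list_pos i = (if i = 0 then 5 else if i = 1 then 0 else if i = 2 then 1 else
     if i = 3 then 2 else if i = 4 then 3 else 4)"

lemma vector_6_nth:
  assumes "length us = 6"
  shows "(vector us :: 'a::zero ^ 6) $ i = us ! list_pos i"
proof -
  obtain u1 u2 u3 u4 u5 u6 where us: "us = [u1, u2, u3, u4, u5, u6]"
    using assms by (auto simp: length_Suc_conv eval_nat_numeral)
  have "\<forall>i. (vector us :: 'a ^ 6) $ i = us ! list_pos i"
    unfolding forall_6 us vector_6 by (simp add: list_pos_def)
  then show ?thesis
    by blast
qed

lemma list_pos_less: "list_pos i < 6"
  by (simp add: list_pos_def)

lemma list_pos_eq_iff: "list_pos i = list_pos j \<longleftrightarrow> i = j"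
proof -
  have "\<forall>i j. list_pos i = list_pos j \<longleftrightarrow> i = j"
    unfolding forall_6 by (simp add: list_pos_def)
  then show ?thesis
    by blast
qed

text \<open>An injection of the six indices into the six list positions is onto, so reading along
  \<open>list_pos\<close> misses no list element.\<close>

lemma range_vector_6:
  assumes "length us = 6"
  shows "range (($) (vector us :: 'a::zero ^ 6)) = set us"
proof -
  have "inj list_pos"
    by (simp add: inj_def list_pos_eq_iff)
  then have "card (range list_pos) = 6"
    by (simp add: card_image)
  then have "range list_pos = {..<6}"
    by (intro card_subset_eq) (auto simp: list_pos_less)
  then have "range (\<lambda>i. us ! list_pos i) = (!) us ` {..<6}"
    by (metis image_image)
  also have "\<dots> = set us"
    using assms by (auto simp: set_conv_nth)
  finally show ?thesis
    using vector_6_nth[OF assms] by (simp cong: image_cong)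
qed

text \<open>This turns columns of an array into rows of the transposed table, so that one criterion
  for rows serves both.\<close>

lemma vector_6_transpose:
  assumes "length xss = 6" and "\<And>xs. xs \<in> set xss \<Longrightarrow> length xs = 6"
  shows "(vector (map vector xss) :: 'a::zero ^ 6 ^ 6) $ i $ j = vector (map vector (List.transpose xss)) $ j $ i"
proof -
  have len: "length (List.transpose xss) = 6"
  proof -
    \<comment> \<open>The length of a transposed list is the maximal row length, computed by this
      fold.\<close>
    have "foldr (\<lambda>xs. max (length xs)) yss 0 = 6"
      if "yss \<noteq> []" "\<And>ys. ys \<in> set yss \<Longrightarrow> length ys = 6" for yss :: "'a list list"
      using that by (induction yss rule: list_nonempty_induct) simp_all
    then show ?thesis
      using assms unfolding length_transpose by (metis length_0_conv zero_neq_numeral)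
  qed
  have tr: "List.transpose xss ! k = map (\<lambda>xs. xs ! k) xss" if "k < 6" for k
    using assms that len by (simp add: nth_transpose filter_id_conv)
  show ?thesis
    using assms len by (simp add: vector_6_nth list_pos_less tr)
qed

section \<open>Complex inner product and orthonormal bases\<close>

lemma cinner_self: "cinner v v = complex_of_real ((norm v)\<^sup>2)"
proof -
  have "cinner v v = (\<Sum>i\<in>UNIV. complex_of_real ((cmod (v $ i))\<^sup>2))"
    unfolding cinner_def by (intro sum.cong refl) (metis complex_norm_square mult.commute of_real_power)
  also have "\<dots> = complex_of_real ((norm v)\<^sup>2)"
    by (simp add: norm_vec_def L2_set_def sum_nonneg)
  finally show ?thesis .
qed

text \<open>The matrix with rows \<open>f i\<close> has its conjugate transpose as right inverse, hence also as left
  inverse, which expands every vector in the \<open>f i\<close>.\<close>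

lemma orthonormal_basisI:
  fixes f :: "'n::finite \<Rightarrow> complex ^ 'n"
  assumes norm: "\<And>i. norm (f i) = 1"
    and orth: "\<And>i j. i \<noteq> j \<Longrightarrow> cinner (f i) (f j) = 0"
  shows "orthonormal_basis f"
proof -
  define M :: "complex ^ 'n ^ 'n" where "M = (\<chi> i. f i)"
  define N :: "complex ^ 'n ^ 'n" where "N = (\<chi> i j. cnj (f j $ i))"
  have inner: "cinner (f i) (f j) = (if i = j then 1 else 0)" for i j
    using norm orth by (simp add: cinner_self)
  have "M ** N = mat 1"
    unfolding matrix_matrix_mult_def mat_def vec_eq_iff
    using inner[unfolded cinner_def] by (simp add: M_def N_def mult.commute)
  then have "N ** M = mat 1"
    by (simp add: matrix_left_right_inverse)
  then have expand: "v = v v* N v* M" for v :: "complex ^ 'n"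
    by (metis vector_matrix_mul_assoc vector_matrix_mul_rid)
  have "w v* M \<in> vec.span (range f)" for w :: "complex ^ 'n"
  proof -
    have "w v* M = (\<Sum>i\<in>UNIV. w $ i *s f i)"
      by (simp add: vec_eq_iff vector_matrix_mult_def M_def mult.commute)
    then show ?thesis
      by (simp add: vec.span_sum vec.span_scale vec.span_base)
  qed
  then have "vec.span (range f) = UNIV"
    using expand by (metis UNIV_eq_I)
  then show ?thesis
    unfolding orthonormal_basis_def using norm orth by blast
qed

lemma cinner_eq_0_commute: "cinner u v = 0 \<longleftrightarrow> cinner v u = 0"
proof -
  have "cinner u v = cnj (cinner v u)"
    by (simp add: cinner_def mult.commute)
  then show ?thesis
    by simp
qed

text \<open>Orthogonality is symmetric, so it suffices to test each vector against the later ones.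
  \<open>sorted_wrt\<close> expresses this in a form that unfolds on explicit lists.\<close>

lemma orthonormal_basis_vector_6:
  assumes "length us = 6" and norm: "\<forall>u\<in>set us. norm u = 1"
    and orth: "sorted_wrt (\<lambda>u v. cinner u v = 0) us"
  shows "orthonormal_basis (\<lambda>i. (vector us :: (complex ^ 6) ^ 6) $ i)"
proof (rule orthonormal_basisI)
  fix i show "norm ((vector us :: (complex ^ 6) ^ 6) $ i) = 1"
    using assms by (simp add: vector_6_nth list_pos_less)
next
  fix i j :: 6 assume "i \<noteq> j"
  then have "list_pos i < list_pos j \<or> list_pos j < list_pos i"
    using list_pos_eq_iff by (metis linorder_neqE_nat)
  then show "cinner ((vector us :: (complex ^ 6) ^ 6) $ i) (vector us $ j) = 0"
    using assms(1) orth cinner_eq_0_commute[of "us ! list_pos i" "us ! list_pos j"]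
    by (auto simp: vector_6_nth list_pos_less sorted_wrt_iff_nth_less)
qed

section \<open>Phase classes of real vectors\<close>

lemma phase_equiv_refl: "norm u = 1 \<Longrightarrow> (u, u) \<in> phase_equiv"
  unfolding phase_equiv_def by (auto intro!: exI[of _ "0::real"])

text \<open>The phase is a quotient of two real coordinates, taken where \<open>v\<close> does not
  vanish. A real number of modulus 1 is 1 or -1.\<close>

lemma phase_equiv_real:
  assumes "(u, v) \<in> phase_equiv" and "\<And>i. u $ i \<in> \<real>" and "\<And>i. v $ i \<in> \<real>"
  shows "u = v \<or> u = - v"
proof -
  obtain \<alpha> :: real where eq: "u = exp (\<i> * complex_of_real \<alpha>) *s v" and "norm v = 1"
    using assms(1) by (auto simp: phase_equiv_def)
  define c where "c = exp (\<i> * complex_of_real \<alpha>)"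
  have "v \<noteq> 0"
    using \<open>norm v = 1\<close> by auto
  then obtain i where i: "v $ i \<noteq> 0"
    by (auto simp: vec_eq_iff)
  have "c = u $ i / v $ i"
    using i eq by (simp add: c_def)
  then have "c \<in> \<real>"
    using assms(2,3) by simp
  moreover have "cmod c = 1"
    by (simp add: c_def)
  ultimately have "c = 1 \<or> c = - 1"
    by (auto elim!: Reals_cases simp: abs_if split: if_splits)
  then show ?thesis
    using eq by (auto simp: c_def[symmetric])
qed

text \<open>If \<open>u\<close> and \<open>v\<close> have the same image under \<open>r\<close>,
  then \<open>v\<close>, lying in its own image, lies in that of \<open>u\<close>; so
  \<open>u = v\<close>. Hence elements of \<open>A\<close> and classes correspond one to
  one.\<close>

lemma card_quotient_eq_card:
  assumes "\<And>u. u \<in> A \<Longrightarrow> (u, u) \<in> r"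
    and "\<And>u v. u \<in> A \<Longrightarrow> v \<in> A \<Longrightarrow> (u, v) \<in> r \<Longrightarrow> u = v"
  shows "card (A // r) = card A"
proof -
  have "inj_on (\<lambda>u. r `` {u}) A"
    using assms by (intro inj_onI) blast
  moreover have "A // r = (\<lambda>u. r `` {u}) ` A"
    unfolding quotient_def by blast
  ultimately show ?thesis
    by (simp add: card_image)
qed

section \<open>Integer codes for the entries\<close>

text \<open>\<^const>\<open>sqrt\<close> is an odd injective function on all reals, so the codes \<open>0, \<plusminus>1, \<plusminus>2, \<plusminus>4\<close> stand for
  the coordinates \<open>0, \<plusminus>1/2, \<plusminus>1/\<surd>2, \<plusminus>1\<close> that occur in \<^const>\<open>Phi23\<close>, and the sign change of a
  vector is the sign change of its code.\<close>

definition sqrt_vec :: "int list \<Rightarrow> complex ^ 6" where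
  "sqrt_vec ks = (\<Sum>j<6. complex_of_real (sqrt (of_int (ks ! j)) / 2) *s e (of_nat j))"

lemma sqrt_vec_nth:
  "sqrt_vec ks $ 0 = complex_of_real (sqrt (of_int (ks ! 0)) / 2)"
  "sqrt_vec ks $ 1 = complex_of_real (sqrt (of_int (ks ! 1)) / 2)"
  "sqrt_vec ks $ 2 = complex_of_real (sqrt (of_int (ks ! 2)) / 2)"
  "sqrt_vec ks $ 3 = complex_of_real (sqrt (of_int (ks ! 3)) / 2)"
  "sqrt_vec ks $ 4 = complex_of_real (sqrt (of_int (ks ! 4)) / 2)"
  "sqrt_vec ks $ 5 = complex_of_real (sqrt (of_int (ks ! 5)) / 2)"
  by (simp_all add: sqrt_vec_def eval_nat_numeral e_def axis_def)

lemma sqrt_vec_Reals: "sqrt_vec ks $ i \<in> \<real>"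
proof -
  have "\<forall>i. sqrt_vec ks $ i \<in> \<real>"
    unfolding forall_6 sqrt_vec_nth by (intro conjI Reals_of_real)
  then show ?thesis
    by blast
qed

text \<open>Injectivity of \<open>sqrt\<close> reduces equality of complex vectors to equality of
  integer lists, which can be decided by evaluation.\<close>

lemma sqrt_vec_eq_iff:
  assumes "length ks = 6" "length ls = 6"
  shows "sqrt_vec ks = sqrt_vec ls \<longleftrightarrow> ks = ls"
proof
  assume "sqrt_vec ks = sqrt_vec ls"
  then have "\<forall>i. sqrt_vec ks $ i = sqrt_vec ls $ i"
    by simp
  then have eq: "ks ! 0 = ls ! 0 \<and> ks ! 1 = ls ! 1 \<and> ks ! 2 = ls ! 2 \<and>
      ks ! 3 = ls ! 3 \<and> ks ! 4 = ls ! 4 \<and> ks ! 5 = ls ! 5"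
    unfolding forall_6 sqrt_vec_nth of_real_eq_iff by simp
  have "{..<6} = {0, 1, 2, 3, 4, 5 :: nat}"
    by auto
  then have "\<forall>j\<in>{..<6}. ks ! j = ls ! j"
    using eq by simp
  then show "ks = ls"
    using assms by (intro nth_equalityI) simp_all
qed simp

lemma sqrt_vec_uminus:
  assumes "length ks = 6"
  shows "sqrt_vec (map uminus ks) = - sqrt_vec ks"
  using assms by (simp add: vec_eq_iff forall_6 sqrt_vec_nth real_sqrt_minus)

text \<open>The coordinates are real, so conjugation disappears, and the odd \<open>sqrt\<close> is
  multiplicative for all signs. The two factors 1/2 give the denominator 4.\<close>

lemma cinner_sqrt_vec:
  "cinner (sqrt_vec ks) (sqrt_vec ls) = complex_of_real ((\<Sum>j<6. sqrt (of_int (ks ! j * ls ! j))) / 4)"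
  by (simp add: cinner_def sum_6 sqrt_vec_nth eval_nat_numeral real_sqrt_mult add_divide_distrib)

text \<open>In the inner product of a vector with itself each term is the root of a square, hence an
  absolute value. A code gives a unit vector exactly when its absolute values sum to 4.\<close>

lemma norm_sqrt_vec: "norm (sqrt_vec ks) = sqrt (of_int (\<Sum>j<6. \<bar>ks ! j\<bar>)) / 2"
proof -
  have "(norm (sqrt_vec ks))\<^sup>2 = of_int (\<Sum>j<6. \<bar>ks ! j\<bar>) / 4"
    using cinner_self[of "sqrt_vec ks"] unfolding cinner_sqrt_vec of_real_eq_iff
    by simp
  then show ?thesis
    by (metis norm_ge_zero real_sqrt_divide real_sqrt_four real_sqrt_unique)
qed

text \<open>Rows and columns are in the displayed order of the array, and each code lists the
  coordinates at \<open>e 0\<close> to \<open>e 5\<close>.\<close>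

definition codes :: "int list list list" where
  "codes =
   [[[0,0,0,0,4,0], [4,0,0,0,0,0], [0,0,0,0,0,4], [0,4,0,0,0,0], [0,0,4,0,0,0], [0,0,0,4,0,0]],
    [[0,0,0,0,0,4], [0,0,0,0,4,0], [0,2,1,1,0,0], [2,0,1,-1,0,0], [1,-1,0,2,0,0], [-1,-1,2,0,0,0]],
    [[0,-2,1,1,0,0], [0,0,0,0,0,4], [0,0,0,0,4,0], [-2,0,1,-1,0,0], [-1,1,0,2,0,0], [1,1,2,0,0,0]],
    [[-1,1,2,0,0,0], [0,0,0,4,0,0], [1,-1,2,0,0,0], [0,0,0,0,2,2], [2,2,0,0,0,0], [0,0,0,0,2,-2]],
    [[1,1,0,2,0,0], [0,0,4,0,0,0], [-1,-1,0,2,0,0], [0,0,0,0,2,-2], [0,0,0,0,2,2], [-2,2,0,0,0,0]],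
    [[2,0,1,-1,0,0], [0,4,0,0,0,0], [-2,0,1,-1,0,0], [0,0,2,2,0,0], [0,0,0,0,2,-2], [0,0,0,0,2,2]]]"

lemma tuple4_eq_sqrt_vec:
  assumes "t0 = sqrt (of_int k0) / 2" "t1 = sqrt (of_int k1) / 2"
    "t2 = sqrt (of_int k2) / 2" "t3 = sqrt (of_int k3) / 2"
  shows "tuple4 t0 t1 t2 t3 = sqrt_vec [k0, k1, k2, k3, 0, 0]"
  by (simp add: assms vec_eq_iff forall_6 sqrt_vec_nth tuple4_def e_def axis_def)

lemma e_eq_sqrt_vec:
  "e 4 = sqrt_vec [0, 0, 0, 0, 4, 0]"
  "e 5 = sqrt_vec [0, 0, 0, 0, 0, 4]"
  "complex_of_real (sqrt 2 / 2) *s (e 4 + e 5) = sqrt_vec [0, 0, 0, 0, 2, 2]"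
  "complex_of_real (sqrt 2 / 2) *s (e 4 - e 5) = sqrt_vec [0, 0, 0, 0, 2, -2]"
  by (simp_all add: vec_eq_iff forall_6 sqrt_vec_nth e_def axis_def real_sqrt_minus)

text \<open>This brings a, b and rho, all equal here, into the shape sqrt k / 2 of a coded
  coordinate.\<close>

lemma inverse_sqrt_2: "1 / sqrt 2 = sqrt 2 / 2"
  by (simp add: real_div_sqrt field_simps)

lemma Phi23_eq: "Phi23 = vector (map vector (map (map sqrt_vec) codes))"
  unfolding Phi23_def Phi_def Let_def codes_def list.map inverse_sqrt_2
  \<comment> \<open>Descending through the nested lists compares the arrays entry by entry; what
    remains are numerical identities for the real coordinates.\<close>
  by (intro arg_cong[where f = vector] arg_cong2[where f = Cons] refl e_eq_sqrt_vec tuple4_eq_sqrt_vec)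
    (simp_all add: real_sqrt_minus)

lemma length_codes: "length codes = 6" "kss \<in> set codes \<Longrightarrow> length kss = 6"
  by (auto simp: codes_def)

lemma norm_codes: "\<forall>kss\<in>set codes. \<forall>ks\<in>set kss. norm (sqrt_vec ks) = 1"
  by (simp add: codes_def norm_sqrt_vec eval_nat_numeral)

lemma rows_orthogonal:
  "\<forall>kss\<in>set codes. sorted_wrt (\<lambda>ks ls. cinner (sqrt_vec ks) (sqrt_vec ls) = 0) kss"
  by (simp add: codes_def cinner_sqrt_vec eval_nat_numeral real_sqrt_minus)

lemma columns_orthogonal:
  "\<forall>kss\<in>set (List.transpose codes). sorted_wrt (\<lambda>ks ls. cinner (sqrt_vec ks) (sqrt_vec ls) = 0) kss"
  by (simp add: codes_def cinner_sqrt_vec eval_nat_numeral real_sqrt_minus)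

section \<open>The Latin square property and the count of classes\<close>

lemma Phi23_quantum_latin_square: "quantum_latin_square Phi23"
proof -
  \<comment> \<open>Stated for an arbitrary table of codes, in order to be applied to
    \<open>codes\<close> for the rows and to its transpose for the columns.\<close>
  have basis: "orthonormal_basis (\<lambda>j. (vector (map vector (map (map sqrt_vec) kss)) :: (complex ^ 6) ^ 6 ^ 6) $ i $ j)"
    if "length kss = 6" "\<And>r. r \<in> set kss \<Longrightarrow> length r = 6"
      "\<forall>r\<in>set kss. \<forall>ks\<in>set r. norm (sqrt_vec ks) = 1"
      "\<forall>r\<in>set kss. sorted_wrt (\<lambda>ks ls. cinner (sqrt_vec ks) (sqrt_vec ls) = 0) r" for kss i
  proof -
    have mem: "kss ! list_pos i \<in> set kss"
      using that(1) list_pos_less by simp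
    have "orthonormal_basis (\<lambda>j. (vector (map sqrt_vec (kss ! list_pos i)) :: (complex ^ 6) ^ 6) $ j)"
      using that mem by (intro orthonormal_basis_vector_6) (simp_all add: sorted_wrt_map)
    then show ?thesis
      using that(1) by (simp add: vector_6_nth[of "map _ _"] list_pos_less)
  qed
  have rows: "orthonormal_basis (\<lambda>j. Phi23 $ i $ j)" for i
    unfolding Phi23_eq using length_codes norm_codes rows_orthogonal by (rule basis)
  have "Phi23 $ i $ j = vector (map vector (map (map sqrt_vec) (List.transpose codes))) $ j $ i" for i j
    unfolding Phi23_eq transpose_map_map[symmetric]
    by (rule vector_6_transpose) (use length_codes in auto)
  moreover have "length (List.transpose codes) = 6" "r \<in> set (List.transpose codes) \<Longrightarrow> length r = 6" for r
    by (auto simp: codes_def)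
  moreover have "\<forall>r\<in>set (List.transpose codes). \<forall>ks\<in>set r. norm (sqrt_vec ks) = 1"
    by (simp add: codes_def norm_sqrt_vec eval_nat_numeral)
  ultimately have cols: "orthonormal_basis (\<lambda>i. Phi23 $ i $ j)" for j
    using basis columns_orthogonal by simp
  show ?thesis
    unfolding quantum_latin_square_def using rows cols
    by (auto simp: orthonormal_basis_def)
qed

lemma Phi23_entries: "{Phi23 $ i $ j | i j. True} = sqrt_vec ` set (concat codes)"
proof -
  have "{Phi23 $ i $ j | i j. True} = (\<Union>v\<in>range (($) Phi23). range (($) v))"
    by auto
  also have "\<dots> = (\<Union>kss\<in>set codes. range (($) (vector (map sqrt_vec kss) :: (complex ^ 6) ^ 6)))"
    using length_codes(1) by (simp add: Phi23_eq range_vector_6)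
  also have "\<dots> = sqrt_vec ` set (concat codes)"
    using length_codes(2) by (simp add: range_vector_6 image_UN)
  finally show ?thesis .
qed

lemma Phi23_cardinality: "qls_cardinality Phi23 = 23"
proof -
  let ?K = "set (concat codes)"
  have len: "length ks = 6" if "ks \<in> ?K" for ks
    using that by (auto simp: codes_def)
  \<comment> \<open>This excludes the sign -1 that phase equivalence of real vectors leaves
    open.\<close>
  have no_neg: "\<forall>ks\<in>?K. map uminus ks \<notin> ?K"
    by code_simp
  have "card (sqrt_vec ` ?K) = card ?K"
    by (intro card_image inj_onI) (use len sqrt_vec_eq_iff in blast)
  moreover have "card ?K = 23"
    by code_simp
  moreover have "card (sqrt_vec ` ?K // phase_equiv) = card (sqrt_vec ` ?K)"
  proof (rule card_quotient_eq_card)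
    fix u assume "u \<in> sqrt_vec ` ?K"
    then have "norm u = 1"
      using Phi23_quantum_latin_square
      unfolding quantum_latin_square_def Phi23_entries[symmetric] by blast
    then show "(u, u) \<in> phase_equiv"
      by (rule phase_equiv_refl)
  next
    fix u v assume "u \<in> sqrt_vec ` ?K" "v \<in> sqrt_vec ` ?K" and uv: "(u, v) \<in> phase_equiv"
    then obtain ks ls where ks: "u = sqrt_vec ks" "ks \<in> ?K" and ls: "v = sqrt_vec ls" "ls \<in> ?K"
      by blast
    \<comment> \<open>Otherwise the negated code of \<open>v\<close> would be the code of
      \<open>u\<close> and hence lie in the table.\<close>
    have "u \<noteq> - v"
      using ks ls len no_neg sqrt_vec_uminus sqrt_vec_eq_iff by (metis length_map)
    then show "u = v"
      using phase_equiv_real[OF uv] ks(1) ls(1) sqrt_vec_Reals by blast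
  qed
  ultimately show ?thesis
    unfolding qls_cardinality_def Phi23_entries by simp
qed

theorem theorem3:
  shows "quantum_latin_square Phi23 \<and> qls_cardinality Phi23 = 23"
  using Phi23_quantum_latin_square Phi23_cardinality by blast

end
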